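(* Let $a,b$ be positive integers with $b\ge a$, and define $$f(\alpha,(d_t,d_a,d_b))=(a+b)^\alpha d_t+a d_a+b d_b-a^\alpha-b^\alpha .$$ Then for all $d_t,d_a,d_b\in\mathbb{R}_{\ge 0}$ and all $\alpha\in[0,1)$, $$f(\alpha,(d_t,d_a,d_b))\ \ge\ \min\Big(f(0,(d_t,d_a,d_b)),\ f\Big(1,\Big(\tfrac{\log(a)\,a+\log(b)\,b}{\log(a+b)(a+b)},d_a,d_b\Big)\Big),\ f(1,(d_t,d_a,d_b))\Big).$$ *)

theory Defs
  imports Complex_Main
begin

definition f :: "nat \<Rightarrow> nat \<Rightarrow> real \<Rightarrow> real \<times> real \<times> real \<Rightarrow> real" where
  "f a b \<alpha> = (\<lambda>(d\<^sub>t, d\<^sub>a, d\<^sub>b).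
     (real a + real b) powr \<alpha> * d\<^sub>t + real a * d\<^sub>a + real b * d\<^sub>b
       - real a powr \<alpha> - real b powr \<alpha>)"

end

theory Submission
  imports Defs
begin

text \<open>
  For fixed \<open>d\<close>, the continuous function \<open>\<alpha> \<mapsto> f \<alpha> d\<close> attains its minimum over \<open>[0, 1]\<close> at some \<open>\<beta>\<close>.
  If \<open>\<beta>\<close> is an endpoint we are done. If it is interior, the derivative vanishes there, so
  \<open>(a + b)\<^sup>\<beta> d\<^sub>t = (a\<^sup>\<beta> log a + b\<^sup>\<beta> log b) / log (a + b)\<close>, and the minimum is
  \<open>a d\<^sub>a + b d\<^sub>b - a\<^sup>\<beta> (1 - log a / log (a + b)) - b\<^sup>\<beta> (1 - log b / log (a + b))\<close>.
  This is decreasing in \<open>\<beta>\<close>, and its value at \<open>\<beta> = 1\<close> is the middle term of the minimum.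
\<close>

lemma f_has_real_derivative:
  assumes "a > 0" "b > 0"
  shows "((\<lambda>\<alpha>. f a b \<alpha> (dt, da, db)) has_real_derivative
    (real a + real b) powr \<alpha> * ln (real a + real b) * dt
      - real a powr \<alpha> * ln (real a) - real b powr \<alpha> * ln (real b)) (at \<alpha>)"
  using assms unfolding f_def by (auto intro!: derivative_eq_intros)

lemma f_critical_ge:
  fixes a b :: nat and dt da db \<beta> :: real
  assumes "a > 0" "b > 0" "\<beta> \<le> 1"
    and crit: "(real a + real b) powr \<beta> * ln (real a + real b) * dt
      = real a powr \<beta> * ln (real a) + real b powr \<beta> * ln (real b)"
  shows "f a b 1 ((ln (real a) * real a + ln (real b) * real b)
           / (ln (real a + real b) * (real a + real b)), da, db) \<le> f a b \<beta> (dt, da, db)"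
proof -
  define s where "s = real a + real b"
  have s: "s > 1" "real a \<le> s" "real b \<le> s"
    using assms by (auto simp: s_def)
  then have L: "ln s > 0" by simp
  \<comment> \<open>A positive integer is at least 1, so \<open>real n powr \<beta>\<close> is at
    most \<open>real n\<close>; the common factor is nonnegative because n is at most
    \<open>s\<close>.\<close>
  have term_le: "real n powr \<beta> * (ln s - ln (real n)) \<le> real n * (ln s - ln (real n))"
    if "n > 0" "real n \<le> s" for n
    using that \<open>\<beta> \<le> 1\<close> powr_mono[of \<beta> 1 "real n"] by (intro mult_right_mono) auto
  \<comment> \<open>This is the sum of \<open>term_le\<close> for \<open>a\<close> and
    \<open>b\<close>, negated, with \<open>crit\<close> eliminating \<open>dt\<close>.\<close>
  have "(ln (real a) * real a + ln (real b) * real b) - ln s * (real a + real b)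
      \<le> ln s * (s powr \<beta> * dt - real a powr \<beta> - real b powr \<beta>)"
    using term_le[of a] term_le[of b] assms s crit[folded s_def] by (simp add: algebra_simps)
  then have "(ln (real a) * real a + ln (real b) * real b) / ln s - real a - real b
      \<le> s powr \<beta> * dt - real a powr \<beta> - real b powr \<beta>"
    using L by (simp add: field_simps)
  \<comment> \<open>At exponent 1 the coefficient of the first coordinate is \<open>s\<close>, which
    cancels the \<open>s\<close> in the denominator.\<close>
  moreover have "s * (x / (ln s * s)) = x / ln s" for x
    using s by simp
  ultimately show ?thesis
    using s assms unfolding f_def s_def[symmetric] by simp
qed

theorem lemma11:
  fixes a b :: nat and d\<^sub>t d\<^sub>a d\<^sub>b \<alpha> :: real
  assumes "a > 0" and "b > 0" and "b \<ge> a"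
    and "d\<^sub>t \<ge> 0" and "d\<^sub>a \<ge> 0" and "d\<^sub>b \<ge> 0"
    and "\<alpha> \<in> {0..<1}"
  shows "f a b \<alpha> (d\<^sub>t, d\<^sub>a, d\<^sub>b) \<ge>
    Min {f a b 0 (d\<^sub>t, d\<^sub>a, d\<^sub>b),
         f a b 1 ((ln (real a) * real a + ln (real b) * real b)
                    / (ln (real a + real b) * (real a + real b)), d\<^sub>a, d\<^sub>b),
         f a b 1 (d\<^sub>t, d\<^sub>a, d\<^sub>b)}"
proof -
  let ?g = "\<lambda>\<alpha>. f a b \<alpha> (d\<^sub>t, d\<^sub>a, d\<^sub>b)"
  note deriv = f_has_real_derivative[OF \<open>a > 0\<close> \<open>b > 0\<close>, of d\<^sub>t d\<^sub>a d\<^sub>b]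
  have "continuous_on {0..1} ?g"
    using deriv by (intro continuous_at_imp_continuous_on ballI DERIV_isCont)
  then obtain \<beta> where \<beta>: "\<beta> \<in> {0..1}" and min: "\<And>x. x \<in> {0..1} \<Longrightarrow> ?g \<beta> \<le> ?g x"
    using continuous_attains_inf[of "{0..1::real}" ?g] by auto
  have "?g \<beta> \<le> ?g \<alpha>"
    using min assms by simp
  moreover consider "\<beta> = 0" | "\<beta> = 1" | "0 < \<beta>" "\<beta> < 1"
    using \<beta> by fastforce
  then have "Min {?g 0,
      f a b 1 ((ln (real a) * real a + ln (real b) * real b)
                 / (ln (real a + real b) * (real a + real b)), d\<^sub>a, d\<^sub>b),
      ?g 1} \<le> ?g \<beta>"
  proof cases
    case 3
    have "(real a + real b) powr \<beta> * ln (real a + real b) * d\<^sub>t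
        - real a powr \<beta> * ln (real a) - real b powr \<beta> * ln (real b) = 0"
    proof (rule DERIV_local_min[OF deriv])
      \<comment> \<open>This radius keeps the neighbourhood of \<beta> inside the unit interval,
        where \<beta> is a minimizer.\<close>
      show "0 < min \<beta> (1 - \<beta>)"
        using 3 by simp
      show "\<forall>y. \<bar>\<beta> - y\<bar> < min \<beta> (1 - \<beta>) \<longrightarrow> ?g \<beta> \<le> ?g y"
        by (intro allI impI min) auto
    qed
    then have "f a b 1 ((ln (real a) * real a + ln (real b) * real b)
        / (ln (real a + real b) * (real a + real b)), d\<^sub>a, d\<^sub>b) \<le> ?g \<beta>"
      using 3 assms by (intro f_critical_ge) auto
    then show ?thesis
      by (simp add: min_le_iff_disj)
  qed (simp_all add: min_le_iff_disj)
  ultimately show ?thesis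
    by (rule order.trans[rotated])
qed

end
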